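(* Let $L$ be a bounded chain and let $n\geqslant 1$. A function $f\colon L^{n}\rightarrow L$ is a discrete Sugeno integral if and only if it is nondecreasing, Boolean min homogeneous, and Boolean max homogeneous.
   Context: A bounded chain is a totally ordered set $L$ with least element $0$ and greatest element $1$, viewed as a lattice with $\wedge=\min$, $\vee=\max$. $L^n$ has the componentwise order and operations. A polynomial function $L^n\to L$ is any function obtained by finitely many applications of: (i) for each $i\in\{1,\ldots,n\}$ and $c\in L$, the projection $\mathbf{x}\mapsto x_i$ and the constant function $\mathbf{x}\mapsto c$ are polynomial functions; (ii) if $f,g$ are polynomial functions then so are $f\vee g$ and $f\wedge g$ (pointwise). A discrete Sugeno integral is a polynomial function $f\colon L^n\to L$ that is $\{0,1\}$-idempotent, i.e. $f(0,\ldots,0)=0$ and $f(1,\ldots,1)=1$. $f$ is nondecreasing if $\mathbf{a}\leqslant\mathbf{b}$ implies $f(\mathbf{a})\leqslant f(\mathbf{b})$. For $c\in L$, $\mathbf{x}\wedge c=(x_1\wedge c,\ldots,x_n\wedge c)$ and $\mathbf{x}\vee c=(x_1\vee c,\ldots,x_n\vee c)$. $f$ is Boolean min homogeneous if $f(\mathbf{x}\wedge c)=f(\mathbf{x})\wedge c$ for every $\mathbf{x}\in\{0,1\}^n$ and every $c\in L$; it is Boolean max homogeneous if $f(\mathbf{x}\vee c)=f(\mathbf{x})\vee c$ for every $\mathbf{x}\in\{0,1\}^n$ and every $c\in L$. *)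

theory Defs
  imports Main
begin

text \<open>
  A bounded chain is a type of sort \<open>{linorder, order_bot, order_top}\<close>, with \<open>bot\<close> as 0,
  \<open>top\<close> as 1, and lattice operations \<open>min\<close> and \<open>max\<close>; the one-element chain is included.
  The power \<open>L^n\<close> with \<open>n \<ge> 1\<close> is the function type \<open>'n \<Rightarrow> 'a\<close> for a finite
  (hence nonempty) index type \<open>'n\<close>, carrying the library's pointwise order.
\<close>

inductive polynomial_function ::
    "(('n::finite \<Rightarrow> 'a::{linorder,order_bot,order_top}) \<Rightarrow> 'a) \<Rightarrow> bool" where
  proj: "polynomial_function (\<lambda>x. x i)"
| const: "polynomial_function (\<lambda>x. c)"
| join: "polynomial_function f \<Longrightarrow> polynomial_function g \<Longrightarrow>
    polynomial_function (\<lambda>x. max (f x) (g x))"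
| meet: "polynomial_function f \<Longrightarrow> polynomial_function g \<Longrightarrow>
    polynomial_function (\<lambda>x. min (f x) (g x))"

definition discrete_Sugeno_integral ::
    "(('n::finite \<Rightarrow> 'a::{linorder,order_bot,order_top}) \<Rightarrow> 'a) \<Rightarrow> bool" where
  "discrete_Sugeno_integral f \<longleftrightarrow>
    polynomial_function f \<and> f (\<lambda>i. bot) = bot \<and> f (\<lambda>i. top) = top"

definition Boolean_min_homogeneous ::
    "(('n::finite \<Rightarrow> 'a::{linorder,order_bot,order_top}) \<Rightarrow> 'a) \<Rightarrow> bool" where
  "Boolean_min_homogeneous f \<longleftrightarrow>
    (\<forall>x c. (\<forall>i. x i \<in> {bot, top}) \<longrightarrow> f (\<lambda>i. min (x i) c) = min (f x) c)"

definition Boolean_max_homogeneous ::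
    "(('n::finite \<Rightarrow> 'a::{linorder,order_bot,order_top}) \<Rightarrow> 'a) \<Rightarrow> bool" where
  "Boolean_max_homogeneous f \<longleftrightarrow>
    (\<forall>x c. (\<forall>i. x i \<in> {bot, top}) \<longrightarrow> f (\<lambda>i. max (x i) c) = max (f x) c)"

end

theory Submission
  imports Defs
begin

text \<open>
  Every polynomial function \<open>f\<close> is nondecreasing, and distributivity shows that truncating its
  arguments at level \<open>c\<close> cannot be noticed once the value is truncated at \<open>c\<close> as well:
  \<open>min (f (x \<and> c)) c = min (f x) c\<close>, and dually for \<open>max\<close>. For a Sugeno integral, applying both
  identities to the constant tuples \<open>1\<close> and \<open>0\<close> gives \<open>f (c, \<dots>, c) = c\<close>; hence
  \<open>f (x \<and> c) \<le> c\<close>, the outer truncation on the left is redundant, and homogeneity follows.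

  Conversely, the three conditions force \<open>f\<close> to equal the polynomial function in disjunctive
  normal form \<open>x \<mapsto> Max\<^sub>A (f 1\<^sub>A \<and> (Min\<^sub>i\<^sub>\<in>\<^sub>A x\<^sub>i))\<close>, where \<open>1\<^sub>A\<close> is the characteristic tuple of
  the set \<open>A\<close> of indices. Min homogeneity bounds every term by \<open>f x\<close>, because
  \<open>1\<^sub>A \<and> (Min\<^sub>i\<^sub>\<in>\<^sub>A x\<^sub>i) \<le> x\<close>. Max homogeneity shows that the upper level set
  \<open>A = {i. f x \<le> x\<^sub>i}\<close> attains the bound: \<open>x\<close> lies below \<open>1\<^sub>A \<or> d\<close>, where \<open>d\<close> is the largest
  component of \<open>x\<close> outside \<open>A\<close>, so \<open>f x \<le> f 1\<^sub>A \<or> d\<close>; as \<open>d < f x\<close> unless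
  \<open>f x = 0\<close>, the bound must come from \<open>f 1\<^sub>A\<close>.
\<close>

lemma polynomial_function_mono:
  assumes "polynomial_function f"
  shows "mono f"
  using assms
proof induction
  case (join f g)
  then show ?case by (intro monoI max.mono) (blast dest: monoD)+
next
  case (meet f g)
  then show ?case by (intro monoI min.mono) (blast dest: monoD)+
qed (auto intro!: monoI dest: le_funD)

text \<open>
  In a chain \<open>t \<mapsto> min t c\<close> is a lattice homomorphism, so it commutes with the two operations
  that build a polynomial function; on projections and constants the identity is idempotence.
\<close>

lemma polynomial_function_min_truncation:
  assumes "polynomial_function f"
  shows "min (f (\<lambda>i. min (x i) c)) c = min (f x) c"
  using assms
proof induction
  case (join f g)
  then show ?case by (simp only: min_max_distrib1)
next
  case (meet f g)
  have "min (min a b) c = min (min a c) (min b c)" for a b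
    by (simp add: ac_simps)
  with meet.IH show ?case by (simp only:)
qed simp_all

lemma polynomial_function_max_truncation:
  assumes "polynomial_function f"
  shows "max (f (\<lambda>i. max (x i) c)) c = max (f x) c"
  using assms
proof induction
  case (join f g)
  have "max (max a b) c = max (max a c) (max b c)" for a b
    by (simp add: ac_simps)
  with join.IH show ?case by (simp only:)
next
  case (meet f g)
  then show ?case by (simp only: max_min_distrib1)
qed simp_all

text \<open>
  The value at a constant tuple \<open>c\<close> is at least \<open>c\<close> because \<open>c\<close> is a truncation of \<open>top\<close> from above,
  and at most \<open>c\<close> because it is a truncation of \<open>bot\<close> from below.
\<close>

lemma discrete_Sugeno_integral_idempotent:
  assumes "discrete_Sugeno_integral f"
  shows "f (\<lambda>i. c) = c"
proof (rule antisym)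
  have poly: "polynomial_function f" and "f (\<lambda>i. bot) = bot" "f (\<lambda>i. top) = top"
    using assms by (auto simp: discrete_Sugeno_integral_def)
  then show "f (\<lambda>i. c) \<le> c"
    using polynomial_function_max_truncation[OF poly, of "\<lambda>i. bot" c]
    by (simp add: max_def split: if_splits)
  show "c \<le> f (\<lambda>i. c)"
    using polynomial_function_min_truncation[OF poly, of "\<lambda>i. top" c] \<open>f (\<lambda>i. top) = top\<close>
    by (simp add: min_def top_unique split: if_splits)
qed

lemma discrete_Sugeno_integral_min_homogeneous:
  assumes "discrete_Sugeno_integral f"
  shows "f (\<lambda>i. min (x i) c) = min (f x) c"
proof -
  have poly: "polynomial_function f"
    using assms by (simp add: discrete_Sugeno_integral_def)
  have "f (\<lambda>i. min (x i) c) \<le> f (\<lambda>i. c)"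
    by (rule monoD[OF polynomial_function_mono[OF poly]]) (simp add: le_fun_def)
  then show ?thesis
    using polynomial_function_min_truncation[OF poly, of x c]
    unfolding discrete_Sugeno_integral_idempotent[OF assms] by (simp add: min_absorb1)
qed

lemma discrete_Sugeno_integral_max_homogeneous:
  assumes "discrete_Sugeno_integral f"
  shows "f (\<lambda>i. max (x i) c) = max (f x) c"
proof -
  have poly: "polynomial_function f"
    using assms by (simp add: discrete_Sugeno_integral_def)
  have "f (\<lambda>i. c) \<le> f (\<lambda>i. max (x i) c)"
    by (rule monoD[OF polynomial_function_mono[OF poly]]) (simp add: le_fun_def)
  then show ?thesis
    using polynomial_function_max_truncation[OF poly, of x c]
    unfolding discrete_Sugeno_integral_idempotent[OF assms] by (simp add: max_absorb1)
qed

text \<open>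
  Inserting the neutral element gives the empty join its lattice value \<open>bot\<close>, where \<open>Max {}\<close> would
  be unspecified. The same device is used for meets.
\<close>

lemma polynomial_function_Max:
  assumes "finite S" "\<And>s. s \<in> S \<Longrightarrow> polynomial_function (g s)"
  shows "polynomial_function (\<lambda>x. Max (insert bot ((\<lambda>s. g s x) ` S)))"
  using assms
proof (induction S)
  case empty
  show ?case by (simp add: polynomial_function.const)
next
  case (insert s S)
  have "Max (insert bot ((\<lambda>s. g s x) ` insert s S))
      = max (g s x) (Max (insert bot ((\<lambda>s. g s x) ` S)))" for x
    using insert.hyps by (simp add: insert_commute[of bot "g s x"])
  then show ?case
    by (simp only:) (intro polynomial_function.join insert.IH insert.prems; simp)
qed

lemma polynomial_function_Min:
  assumes "finite S" "\<And>s. s \<in> S \<Longrightarrow> polynomial_function (g s)"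
  shows "polynomial_function (\<lambda>x. Min (insert top ((\<lambda>s. g s x) ` S)))"
  using assms
proof (induction S)
  case empty
  show ?case by (simp add: polynomial_function.const)
next
  case (insert s S)
  have "Min (insert top ((\<lambda>s. g s x) ` insert s S))
      = min (g s x) (Min (insert top ((\<lambda>s. g s x) ` S)))" for x
    using insert.hyps by (simp add: insert_commute[of top "g s x"])
  then show ?case
    by (simp only:) (intro polynomial_function.meet insert.IH insert.prems; simp)
qed

definition characteristic_tuple :: "'n set \<Rightarrow> 'n \<Rightarrow> 'a::{order_bot,order_top}" where
  "characteristic_tuple A = (\<lambda>i. if i \<in> A then top else bot)"

definition disjunctive_normal_form ::
    "('n set \<Rightarrow> 'a) \<Rightarrow> ('n::finite \<Rightarrow> 'a::{linorder,order_bot,order_top}) \<Rightarrow> 'a" where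
  "disjunctive_normal_form w x =
    Max (insert bot (range (\<lambda>A. min (w A) (Min (insert top (x ` A))))))"

lemma polynomial_function_disjunctive_normal_form:
  "polynomial_function (disjunctive_normal_form w)"
proof -
  have "polynomial_function (\<lambda>x. min (w A) (Min (insert top (x ` A))))" for A
    using polynomial_function_Min[of A "\<lambda>i x. x i"]
    by (intro polynomial_function.meet polynomial_function.const)
      (simp add: polynomial_function.proj)
  from polynomial_function_Max[OF finite this] show ?thesis
    unfolding disjunctive_normal_form_def .
qed

text \<open>
  The function is recovered from its values at the vertices of the cube: the lower bound on \<open>f x\<close>
  uses min homogeneity, the upper bound max homogeneity.
\<close>

lemma Boolean_homogeneous_eq_disjunctive_normal_form:
  assumes mono: "mono f"
    and minhom: "Boolean_min_homogeneous f"
    and maxhom: "Boolean_max_homogeneous f"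
  shows "f = disjunctive_normal_form (\<lambda>A. f (characteristic_tuple A))"
proof (rule ext, rule antisym)
  fix x
  show "disjunctive_normal_form (\<lambda>A. f (characteristic_tuple A)) x \<le> f x"
  proof -
    have "min (f (characteristic_tuple A)) (Min (insert top (x ` A))) \<le> f x" for A
    proof -
      define c where "c = Min (insert top (x ` A))"
      have "c \<le> x i" if "i \<in> A" for i
        using that by (simp add: c_def)
      then have "(\<lambda>i. min (characteristic_tuple A i) c) \<le> x"
        by (auto simp: le_fun_def characteristic_tuple_def min_le_iff_disj)
      then have "f (\<lambda>i. min (characteristic_tuple A i) c) \<le> f x"
        using mono by (rule monoD[rotated])
      moreover have "f (\<lambda>i. min (characteristic_tuple A i) c) = min (f (characteristic_tuple A)) c"
        using minhom by (simp add: Boolean_min_homogeneous_def characteristic_tuple_def)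
      ultimately show ?thesis by (simp add: c_def)
    qed
    then show ?thesis by (auto simp: disjunctive_normal_form_def)
  qed
  show "f x \<le> disjunctive_normal_form (\<lambda>A. f (characteristic_tuple A)) x"
  proof -
    define A where "A = {i. f x \<le> x i}"
    \<comment> \<open>If \<open>A\<close> contains all indices, \<open>d\<close> is \<open>bot\<close>, so \<open>d < f x\<close> can fail only for \<open>f x = bot\<close>.\<close>
    define d where "d = Max (insert bot (x ` (- A)))"
    have d_small: "d < f x \<or> f x = bot"
      using bot.not_eq_extremum[of "f x"] by (auto simp: d_def A_def)
    have "x i \<le> d" if "i \<notin> A" for i
      using that by (simp add: d_def)
    then have "x \<le> (\<lambda>i. max (characteristic_tuple A i) d)"
      by (auto simp: le_fun_def characteristic_tuple_def le_max_iff_disj)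
    then have "f x \<le> f (\<lambda>i. max (characteristic_tuple A i) d)"
      using mono by (rule monoD[rotated])
    also have "\<dots> = max (f (characteristic_tuple A)) d"
      using maxhom by (simp add: Boolean_max_homogeneous_def characteristic_tuple_def)
    finally have "f x \<le> f (characteristic_tuple A)"
      using d_small by (auto simp: le_max_iff_disj)
    moreover have "f x \<le> Min (insert top (x ` A))"
      by (simp add: A_def)
    ultimately have "f x \<le> min (f (characteristic_tuple A)) (Min (insert top (x ` A)))"
      by simp
    also have "\<dots> \<le> disjunctive_normal_form (\<lambda>A. f (characteristic_tuple A)) x"
      unfolding disjunctive_normal_form_def by (rule Max_ge) auto
    finally show ?thesis .
  qed
qed

theorem theorem28:
  fixes f :: "('n::finite \<Rightarrow> 'a::{linorder,order_bot,order_top}) \<Rightarrow> 'a"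
  shows "discrete_Sugeno_integral f \<longleftrightarrow>
    mono f \<and> Boolean_min_homogeneous f \<and> Boolean_max_homogeneous f"
proof
  assume sugeno: "discrete_Sugeno_integral f"
  then have "mono f"
    by (intro polynomial_function_mono) (simp add: discrete_Sugeno_integral_def)
  moreover have "Boolean_min_homogeneous f"
    unfolding Boolean_min_homogeneous_def
    by (intro allI impI discrete_Sugeno_integral_min_homogeneous[OF sugeno])
  moreover have "Boolean_max_homogeneous f"
    unfolding Boolean_max_homogeneous_def
    by (intro allI impI discrete_Sugeno_integral_max_homogeneous[OF sugeno])
  ultimately show "mono f \<and> Boolean_min_homogeneous f \<and> Boolean_max_homogeneous f"
    by blast
next
  assume hom: "mono f \<and> Boolean_min_homogeneous f \<and> Boolean_max_homogeneous f"
  then have "f = disjunctive_normal_form (\<lambda>A. f (characteristic_tuple A))"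
    by (intro Boolean_homogeneous_eq_disjunctive_normal_form) auto
  then have "polynomial_function f"
    by (rule ssubst) (rule polynomial_function_disjunctive_normal_form)
  \<comment> \<open>The boundary values are homogeneity at the extreme levels \<open>c = bot\<close> and \<open>c = top\<close>.\<close>
  moreover have "f (\<lambda>i. bot) = bot"
  proof -
    have "f (\<lambda>i. min (x i) c) = min (f x) c" if "\<forall>i. x i \<in> {bot, top}" for x c
      using hom that by (simp add: Boolean_min_homogeneous_def)
    from this[of "\<lambda>i. bot" bot] show ?thesis by (simp add: min_absorb2)
  qed
  moreover have "f (\<lambda>i. top) = top"
  proof -
    have "f (\<lambda>i. max (x i) c) = max (f x) c" if "\<forall>i. x i \<in> {bot, top}" for x c
      using hom that by (simp add: Boolean_max_homogeneous_def)
    from this[of "\<lambda>i. top" top] show ?thesis by (simp add: max_absorb2)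
  qed
  ultimately show "discrete_Sugeno_integral f"
    by (simp add: discrete_Sugeno_integral_def)
qed

end
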